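(* Let $\Gamma$ be an infinite set and let $M=\Gamma\cup\{0\}\cup\{z\}$ (with $0,z\notin\Gamma$ and $0\ne z$) be the metric space, with designated origin $0$, whose distance is given by $d(x,x)=0$, $d(z,0)=d(0,z)=2$, and $d(x,y)=1$ for all other pairs $x\neq y$. Let $X$ be a Banach space, let $y\in S_X$, and for $\alpha>0$ put $$S_\alpha:=\{f\in B_{Lip(M,X^* )}: f(z)(y)>2-\alpha\}.$$ If $X^*$ has the weak-star slice diameter two property, then $\inf_{\alpha>0}\operatorname{diam}(S_\alpha)=2$.
   Context: All Banach spaces are real; $B_X$ and $S_X$ denote the closed unit ball and unit sphere of $X$. $Lip(M,X^* )$ is the Banach space of all Lipschitz functions $f:M\to X^*$ with $f(0)=0$, with norm $\|f\|=\sup\{\|f(u)-f(v)\|/d(u,v): u\neq v\in M\}$; diameters are taken with respect to this norm. (The set $S_\alpha$ is the weak-star slice $S(B_{Lip(M,X^* )},\varphi,\alpha/2)=\{f\in B_{Lip(M,X^* )}:\varphi(f)>1-\alpha/2\}$ given by the norm-one functional $\varphi=\tfrac12\delta_{z,y}$, where $\delta_{z,y}(f)=f(z)(y)$.) A weak-star slice of $B_{X^*}$ is a set $S(B_{X^*},x,\alpha)=\{x^*\in B_{X^*}: x^*(x)>1-\alpha\}$ with $x\in S_X$, $\alpha>0$. The dual space $X^*$ has the weak-star slice diameter two property if every weak-star slice of $B_{X^*}$ has diameter two. *)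

theory Defs
  imports "HOL-Analysis.Analysis"
begin

text \<open>A pointed metric space is a type of sort \<open>{metric_space, zero}\<close>; its element \<open>0\<close> carries no
  algebraic structure and serves only as the designated origin.\<close>

typedef (overloaded) ('m, 'b) lip =
  "{f :: 'm::{metric_space,zero} \<Rightarrow> 'b::real_normed_vector. f 0 = 0 \<and> (\<exists>C. C-lipschitz_on UNIV f)}"
  morphisms lip_apply Lip
  by (rule exI[of _ "\<lambda>_. 0"]) (auto intro: exI[of _ 0] simp: lipschitz_on_def)

setup_lifting type_definition_lip

text \<open>The difference quotients are nonnegative, so inserting \<open>0\<close> changes the supremum only when
  there is no pair of distinct points, where \<open>Sup {}\<close> would be unspecified.\<close>

definition lip_const :: "('m::metric_space \<Rightarrow> 'b::real_normed_vector) \<Rightarrow> real" where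
  "lip_const f = Sup (insert 0 {norm (f u - f v) / dist u v | u v. u \<noteq> v})"

lemma lip_quotients_bdd_above:
  fixes f :: "'m::metric_space \<Rightarrow> 'b::real_normed_vector"
  assumes "C-lipschitz_on UNIV f"
  shows "bdd_above (insert 0 {norm (f u - f v) / dist u v | u v. u \<noteq> v})"
proof (rule bdd_aboveI[where M = C])
  fix q assume "q \<in> insert 0 {norm (f u - f v) / dist u v | u v. u \<noteq> v}"
  then consider "q = 0" | u v where "u \<noteq> v" "q = norm (f u - f v) / dist u v"
    by auto
  then show "q \<le> C"
  proof cases
    case 1
    then show ?thesis using assms by (simp add: lipschitz_on_def)
  next
    case 2
    then show ?thesis
      using lipschitz_onD[OF assms, of u v] by (simp add: dist_norm divide_le_eq)
  qed
qed

lemma lip_const_nonneg: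
  assumes "C-lipschitz_on UNIV f"
  shows "0 \<le> lip_const f"
  unfolding lip_const_def by (rule cSup_upper[OF _ lip_quotients_bdd_above[OF assms]]) simp

lemma norm_diff_le_lip_const:
  assumes "C-lipschitz_on UNIV f"
  shows "norm (f u - f v) \<le> lip_const f * dist u v"
proof (cases "u = v")
  case False
  have "norm (f u - f v) / dist u v \<le> lip_const f"
    unfolding lip_const_def
    by (rule cSup_upper[OF _ lip_quotients_bdd_above[OF assms]]) (use False in blast)
  then show ?thesis using False by (simp add: divide_le_eq)
qed simp

lemma lip_const_le:
  assumes "0 \<le> K" "\<And>u v. norm (f u - f v) \<le> K * dist u v"
  shows "lip_const f \<le> K"
  unfolding lip_const_def
  by (rule cSup_least) (use assms in \<open>auto simp: divide_le_eq\<close>)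

instantiation lip :: ("{metric_space,zero}", real_normed_vector) real_normed_vector
begin

lift_definition zero_lip :: "('a, 'b) lip" is "\<lambda>_. 0"
  by (auto intro: exI[of _ 0] simp: lipschitz_on_def)

lift_definition plus_lip :: "('a, 'b) lip \<Rightarrow> ('a, 'b) lip \<Rightarrow> ('a, 'b) lip"
  is "\<lambda>f g u. f u + g u"
  by (auto intro: lipschitz_on_add)

lift_definition uminus_lip :: "('a, 'b) lip \<Rightarrow> ('a, 'b) lip" is "\<lambda>f u. - f u"
  by auto

lift_definition minus_lip :: "('a, 'b) lip \<Rightarrow> ('a, 'b) lip \<Rightarrow> ('a, 'b) lip"
  is "\<lambda>f g u. f u - g u"
  by (auto intro: lipschitz_on_diff)

lift_definition scaleR_lip :: "real \<Rightarrow> ('a, 'b) lip \<Rightarrow> ('a, 'b) lip" is "\<lambda>c f u. c *\<^sub>R f u"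
  by (auto intro: lipschitz_on_cmult)

lift_definition norm_lip :: "('a, 'b) lip \<Rightarrow> real" is lip_const .

definition dist_lip :: "('a, 'b) lip \<Rightarrow> ('a, 'b) lip \<Rightarrow> real" where
  "dist_lip f g = norm (f - g)"

definition sgn_lip :: "('a, 'b) lip \<Rightarrow> ('a, 'b) lip" where
  "sgn_lip f = inverse (norm f) *\<^sub>R f"

definition uniformity_lip :: "(('a, 'b) lip \<times> ('a, 'b) lip) filter" where
  "uniformity_lip = (INF e\<in>{0<..}. principal {(f, g). dist f g < e})"

definition open_lip :: "('a, 'b) lip set \<Rightarrow> bool" where
  "open_lip U \<longleftrightarrow> (\<forall>f\<in>U. \<forall>\<^sub>F (f', g) in uniformity. f' = f \<longrightarrow> g \<in> U)"

instance
proof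
  fix f g h :: "('a, 'b) lip" and a b :: real and U :: "('a, 'b) lip set"
  show "f + g + h = f + (g + h)" by transfer (simp add: add.assoc)
  show "f + g = g + f" by transfer (simp add: add.commute)
  show "0 + f = f" by transfer simp
  show "- f + f = 0" by transfer simp
  show "f - g = f + - g" by transfer simp
  show "a *\<^sub>R (f + g) = a *\<^sub>R f + a *\<^sub>R g" by transfer (simp add: scaleR_add_right)
  show "(a + b) *\<^sub>R f = a *\<^sub>R f + b *\<^sub>R f" by transfer (simp add: scaleR_add_left)
  show "a *\<^sub>R b *\<^sub>R f = (a * b) *\<^sub>R f" by transfer simp
  show "1 *\<^sub>R f = f" by transfer simp
  show "dist f g = norm (f - g)" by (rule dist_lip_def)
  show "sgn f = inverse (norm f) *\<^sub>R f" by (rule sgn_lip_def)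
  show "uniformity = (INF e\<in>{0<..}. principal {(f :: ('a, 'b) lip, g). dist f g < e})"
    by (rule uniformity_lip_def)
  show "open U = (\<forall>f\<in>U. \<forall>\<^sub>F (f', g) in uniformity. f' = f \<longrightarrow> g \<in> U)"
    by (rule open_lip_def)
  show norm_eq_0: "norm f = 0 \<longleftrightarrow> f = 0" for f :: "('a, 'b) lip"
  proof transfer
    fix f :: "'a \<Rightarrow> 'b"
    assume "f 0 = 0 \<and> (\<exists>C. C-lipschitz_on UNIV f)"
    then obtain C where 0: "f 0 = 0" and C: "C-lipschitz_on UNIV f" by blast
    show "lip_const f = 0 \<longleftrightarrow> f = (\<lambda>_. 0)"
    proof
      assume "lip_const f = 0"
      then show "f = (\<lambda>_. 0)"
        using norm_diff_le_lip_const[OF C, of _ 0] 0 by auto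
    next
      assume f0: "f = (\<lambda>_. 0)"
      have "lip_const f \<le> 0" by (rule lip_const_le) (simp_all add: f0)
      with lip_const_nonneg[OF C] show "lip_const f = 0" by simp
    qed
  qed
  show "norm (f + g) \<le> norm f + norm g"
  proof transfer
    fix f g :: "'a \<Rightarrow> 'b"
    assume "f 0 = 0 \<and> (\<exists>C. C-lipschitz_on UNIV f)" "g 0 = 0 \<and> (\<exists>C. C-lipschitz_on UNIV g)"
    then obtain C D where C: "C-lipschitz_on UNIV f" and D: "D-lipschitz_on UNIV g" by blast
    show "lip_const (\<lambda>u. f u + g u) \<le> lip_const f + lip_const g"
    proof (rule lip_const_le)
      show "0 \<le> lip_const f + lip_const g"
        using lip_const_nonneg[OF C] lip_const_nonneg[OF D] by simp
      fix u v
      have "norm (f u + g u - (f v + g v)) \<le> norm (f u - f v) + norm (g u - g v)"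
        by (metis add_diff_add norm_triangle_ineq)
      also have "\<dots> \<le> (lip_const f + lip_const g) * dist u v"
        using norm_diff_le_lip_const[OF C, of u v] norm_diff_le_lip_const[OF D, of u v]
        by (simp add: algebra_simps)
      finally show "norm (f u + g u - (f v + g v)) \<le> (lip_const f + lip_const g) * dist u v" .
    qed
  qed
  have scale_le: "norm (c *\<^sub>R k) \<le> \<bar>c\<bar> * norm k" for c and k :: "('a, 'b) lip"
  proof transfer
    fix c and f :: "'a \<Rightarrow> 'b"
    assume "f 0 = 0 \<and> (\<exists>C. C-lipschitz_on UNIV f)"
    then obtain C where C: "C-lipschitz_on UNIV f" by blast
    show "lip_const (\<lambda>u. c *\<^sub>R f u) \<le> \<bar>c\<bar> * lip_const f"
    proof (rule lip_const_le)
      show "0 \<le> \<bar>c\<bar> * lip_const f" using lip_const_nonneg[OF C] by simp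
      show "norm (c *\<^sub>R f u - c *\<^sub>R f v) \<le> \<bar>c\<bar> * lip_const f * dist u v" for u v
        using mult_left_mono[OF norm_diff_le_lip_const[OF C, of u v], of "\<bar>c\<bar>"]
        by (simp flip: scaleR_diff_right add: mult.assoc)
    qed
  qed
  show "norm (a *\<^sub>R f) = \<bar>a\<bar> * norm f"
  proof (cases "a = 0")
    case True
    have "0 *\<^sub>R f = 0" for f :: "('a, 'b) lip" by transfer simp
    with True show ?thesis by (simp add: norm_eq_0)
  next
    case False
    have "inverse a *\<^sub>R a *\<^sub>R f = f" using False by transfer simp
    then have "norm f \<le> \<bar>inverse a\<bar> * norm (a *\<^sub>R f)" using scale_le[of "inverse a" "a *\<^sub>R f"] by simp
    then have "\<bar>a\<bar> * norm f \<le> norm (a *\<^sub>R f)"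
      using False by (simp add: field_simps)
    with scale_le[of a f] show ?thesis by simp
  qed
qed

end

definition weak_star_slice :: "'a::real_normed_vector \<Rightarrow> real \<Rightarrow> ('a \<Rightarrow>\<^sub>L real) set" where
  "weak_star_slice x \<alpha> = {f \<in> cball 0 1. blinfun_apply f x > 1 - \<alpha>}"

text \<open>A property of the dual of \<open>'a\<close>, with the predual passed as a type argument.\<close>

definition weak_star_slice_diameter_two :: "'a::real_normed_vector itself \<Rightarrow> bool" where
  "weak_star_slice_diameter_two _ \<longleftrightarrow>
     (\<forall>(x::'a) \<alpha>. norm x = 1 \<and> \<alpha> > 0 \<longrightarrow> diameter (weak_star_slice x \<alpha>) = 2)"

definition lip_slice ::
    "'m::{metric_space,zero} \<Rightarrow> 'a::real_normed_vector \<Rightarrow> real \<Rightarrow> ('m, 'a \<Rightarrow>\<^sub>L real) lip set" where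
  "lip_slice z y \<alpha> = {f \<in> cball 0 1. blinfun_apply (lip_apply f z) y > 2 - \<alpha>}"

end

theory Submission
  imports Defs
begin

text \<open>The map sending \<open>x\<close> to the Lipschitz function \<open>u \<mapsto> d(u, 0) x\<close> is a linear isometry of any
  normed space into the space of Lipschitz functions. Since \<open>d(z, 0) = 2\<close>, it carries the weak-star
  slice of radius \<open>\<alpha>/2\<close> given by \<open>y\<close> into \<open>S\<^sub>\<alpha>\<close>, so that every \<open>S\<^sub>\<alpha>\<close> already has diameter two.\<close>

text \<open>Reverse triangle inequality for the distance to \<open>w\<close>. With
  \<open>w = 0\<close> it shows both that \<open>radial_lip x\<close> is Lipschitz and that its norm
  is at most \<open>norm x\<close>.\<close>

lemma norm_dist_scaleR_diff_le:
  fixes x :: "'b::real_normed_vector"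
  shows "norm (dist u w *\<^sub>R x - dist v w *\<^sub>R x) \<le> norm x * dist u v"
  using mult_right_mono[OF abs_dist_diff_le[of u w v] norm_ge_zero[of x]]
  by (simp flip: scaleR_diff_left add: mult.commute dist_commute)

lift_definition radial_lip ::
    "'b::real_normed_vector \<Rightarrow> ('m::{metric_space,zero}, 'b) lip" is "\<lambda>x u. dist u 0 *\<^sub>R x"
proof (intro conjI exI)
  fix x :: 'b
  show "(norm x)-lipschitz_on UNIV (\<lambda>u::'m. dist u 0 *\<^sub>R x)"
    by (rule lipschitz_onI)
      (simp_all only: dist_norm[of "_ *\<^sub>R x"] norm_dist_scaleR_diff_le norm_ge_zero)
qed simp

lemma radial_lip_diff: "radial_lip x - radial_lip y = radial_lip (x - y)"
  by transfer (simp add: scaleR_diff_right)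

lemma norm_radial_lip_le: "norm (radial_lip x) \<le> norm x"
  by transfer (rule lip_const_le[OF norm_ge_zero norm_dist_scaleR_diff_le])

lemma norm_lip_apply_le: "norm (lip_apply f u) \<le> norm f * dist u 0"
  by transfer (metis diff_zero norm_diff_le_lip_const)

text \<open>The difference quotient between \<open>u\<close> and the origin equals
  \<open>norm x\<close>, so the upper bound is attained. On a one-point space every radial function
  is zero, hence the point \<open>u\<close>.\<close>

lemma norm_radial_lip:
  fixes x :: "'b::real_normed_vector" and u :: "'m::{metric_space,zero}"
  assumes "u \<noteq> 0"
  shows "norm (radial_lip x :: ('m, 'b) lip) = norm x"
  using norm_lip_apply_le[of "radial_lip x" u] assms
  by (intro antisym norm_radial_lip_le) (simp add: radial_lip.rep_eq mult.commute)

lemma radial_lip_mem_lip_slice: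
  assumes "dist z 0 = 2" "x \<in> weak_star_slice y (\<alpha> / 2)"
  shows "radial_lip x \<in> lip_slice z y \<alpha>"
  using assms norm_radial_lip_le[of x]
  by (auto simp: lip_slice_def weak_star_slice_def radial_lip.rep_eq scaleR_blinfun.rep_eq
      dest: order_trans)

text \<open>\<open>diameter\<close> is a real supremum, so it dominates the distances in a set only
  once the set is known to be bounded.\<close>

lemma bounded_lip_slice: "bounded (lip_slice z y \<alpha>)"
  by (rule bounded_subset[OF bounded_cball[of 0 1]]) (auto simp: lip_slice_def)

lemma diameter_lip_slice_le: "diameter (lip_slice z y \<alpha>) \<le> 2"
proof (rule diameter_le)
  fix f g assume "f \<in> lip_slice z y \<alpha>" "g \<in> lip_slice z y \<alpha>"
  then show "norm (f - g) \<le> 2"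
    using norm_triangle_ineq4[of f g] by (simp add: lip_slice_def)
qed simp

lemma diameter_weak_star_slice_le_lip_slice:
  fixes z :: "'m::{metric_space,zero}" and y :: "'a::real_normed_vector"
  assumes "dist z 0 = 2"
  shows "diameter (weak_star_slice y (\<alpha> / 2)) \<le> diameter (lip_slice z y \<alpha>)"
proof (rule diameter_le)
  \<comment> \<open>The weak-star slice may be empty, since \<open>y\<close> and \<alpha> are
    arbitrary here; the second alternative covers that case.\<close>
  show "weak_star_slice y (\<alpha> / 2) \<noteq> {} \<or> 0 \<le> diameter (lip_slice z y \<alpha>)"
    by (simp add: diameter_ge_0 bounded_lip_slice)
next
  fix p q assume pq: "p \<in> weak_star_slice y (\<alpha> / 2)" "q \<in> weak_star_slice y (\<alpha> / 2)"
  \<comment> \<open>The point \<open>z\<close> is the witness off the origin that makes the radial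
    map isometric.\<close>
  have "z \<noteq> 0" using assms by auto
  then have "norm (p - q) = dist (radial_lip p :: ('m, 'a \<Rightarrow>\<^sub>L real) lip) (radial_lip q)"
    by (simp add: dist_norm radial_lip_diff norm_radial_lip)
  also have "\<dots> \<le> diameter (lip_slice z y \<alpha>)"
    using pq assms
    by (intro diameter_bounded_bound bounded_lip_slice radial_lip_mem_lip_slice)
  finally show "norm (p - q) \<le> diameter (lip_slice z y \<alpha>)" .
qed

theorem proposition2p6:
  fixes \<Gamma> :: "'m::{metric_space,zero} set" and z :: 'm and y :: "'a::banach"
  assumes "infinite \<Gamma>"
    and "(UNIV :: 'm set) = \<Gamma> \<union> {0} \<union> {z}"
    and "0 \<notin> \<Gamma>" and "z \<notin> \<Gamma>" and "0 \<noteq> z"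
    and "dist z 0 = 2"
    and "\<And>u v :: 'm. u \<noteq> v \<Longrightarrow> {u, v} \<noteq> {0, z} \<Longrightarrow> dist u v = 1"
    and "norm y = 1"
    and "weak_star_slice_diameter_two TYPE('a)"
  shows "(INF \<alpha>\<in>{0<..}. diameter (lip_slice z y \<alpha>)) = 2"
proof -
  have "diameter (lip_slice z y \<alpha>) = 2" if "\<alpha> > 0" for \<alpha>
  proof (rule antisym[OF diameter_lip_slice_le])
    have "diameter (weak_star_slice y (\<alpha> / 2)) = 2"
      using assms(8,9) that by (simp add: weak_star_slice_diameter_two_def)
    then show "2 \<le> diameter (lip_slice z y \<alpha>)"
      using diameter_weak_star_slice_le_lip_slice[OF assms(6)] by metis
  qed
  \<comment> \<open>The infimum is that of a constant family over a nonempty index set.\<close>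
  then show ?thesis by simp
qed

end
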